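(* Let $A\in\mathbb{R}^{7\times 7}$ be the matrix $$A=\begin{pmatrix} 0&0&0&0&0&0&0\\ 0&0&0&0&0&0&0\\ 6&-5&-13&0&0&0&0\\ -14&-18&0&0&0&0&0\\ 12&-12&11&0&0&0&0\\ 0&0&0&-6&0&-14&0\\ 0&0&0&6&-18&0&0 \end{pmatrix}.$$ Then $$\left\|\mathcal{L}_A|_{\mathbb{S}_7}\right\|^2<1196<\left\|\mathcal{L}_A|_{\mathbb{K}_7}\right\|^2.$$ In particular, the inequality $\|\mathcal{L}_A|_{\mathbb{K}_7}\|\leq\|\mathcal{L}_A|_{\mathbb{S}_7}\|$ fails for this $A$; equivalently, the maximum of $\|AX+XA^\top\|_F/\|X\|_F$ over all nonzero $X\in\mathbb{R}^{7\times 7}$ is not attained at any symmetric matrix.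
   Context: For $A\in\mathbb{R}^{n\times n}$, the Lyapunov operator is the linear map $\mathcal{L}_A:\mathbb{R}^{n\times n}\to\mathbb{R}^{n\times n}$, $\mathcal{L}_A(X)=AX+XA^\top$. The space $\mathbb{R}^{n\times n}$ carries the Frobenius inner product $\langle X,Y\rangle_F=\operatorname{tr}(X^\top Y)$ and norm $\|X\|_F=\langle X,X\rangle_F^{1/2}$. Let $\mathbb{S}_n=\{X\in\mathbb{R}^{n\times n}:X^\top=X\}$ and $\mathbb{K}_n=\{X\in\mathbb{R}^{n\times n}:X^\top=-X\}$; both subspaces are invariant under $\mathcal{L}_A$. For $\mathbb{U}\in\{\mathbb{S}_n,\mathbb{K}_n\}$, the restricted operator norm is $$\|\mathcal{L}_A|_{\mathbb{U}}\|=\max_{0\ne X\in\mathbb{U}}\frac{\|AX+XA^\top\|_F}{\|X\|_F}.$$ *)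

theory Defs
  imports "HOL-Analysis.Analysis"
begin

definition lyapunov :: "real^'n^'n \<Rightarrow> real^'n^'n \<Rightarrow> real^'n^'n" where
  "lyapunov A X = A ** X + X ** transpose A"

definition frob_inner :: "real^'n^'n \<Rightarrow> real^'n^'n \<Rightarrow> real" where
  "frob_inner X Y = trace (transpose X ** Y)"

definition frob_norm :: "real^'n^'n \<Rightarrow> real" where
  "frob_norm X = sqrt (frob_inner X X)"

definition symmetric_matrices :: "(real^'n^'n) set" where
  "symmetric_matrices = {X. transpose X = X}"

definition skew_matrices :: "(real^'n^'n) set" where
  "skew_matrices = {X. transpose X = - X}"

definition lyapunov_ratio :: "real^'n^'n \<Rightarrow> real^'n^'n \<Rightarrow> real" where
  "lyapunov_ratio A X = frob_norm (lyapunov A X) / frob_norm X"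

(* GREATEST is only meaningful if the maximum exists; lyapunov_norm_attained and
   lyapunov_norm_upper below show that it does on every nonzero subspace U. *)
definition lyapunov_norm :: "real^'n^'n \<Rightarrow> (real^'n^'n) set \<Rightarrow> real" where
  "lyapunov_norm A U = (GREATEST r. \<exists>X\<in>U. X \<noteq> 0 \<and> r = lyapunov_ratio A X)"

definition A7 :: "real^7^7" where
  "A7 = vector
    [vector [  0,   0,   0,  0,   0,   0, 0],
     vector [  0,   0,   0,  0,   0,   0, 0],
     vector [  6,  -5, -13,  0,   0,   0, 0],
     vector [-14, -18,   0,  0,   0,   0, 0],
     vector [ 12, -12,  11,  0,   0,   0, 0],
     vector [  0,   0,   0, -6,   0, -14, 0],
     vector [  0,   0,   0,  6, -18,   0, 0]]"

(* The library states this only for up to three components.  The index 7 is the element 0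
   of the index type 7. *)
lemma vector_7:
  "(vector [a, b, c, d, e, f, g] :: 'a::zero^7) $ 1 = a"
  "(vector [a, b, c, d, e, f, g] :: 'a::zero^7) $ 2 = b"
  "(vector [a, b, c, d, e, f, g] :: 'a::zero^7) $ 3 = c"
  "(vector [a, b, c, d, e, f, g] :: 'a::zero^7) $ 4 = d"
  "(vector [a, b, c, d, e, f, g] :: 'a::zero^7) $ 5 = e"
  "(vector [a, b, c, d, e, f, g] :: 'a::zero^7) $ 6 = f"
  "(vector [a, b, c, d, e, f, g] :: 'a::zero^7) $ 7 = g"
  unfolding vector_def by simp_all

lemma frob_inner_eq_inner: "frob_inner X Y = X \<bullet> Y"
proof -
  have "frob_inner X Y = (\<Sum>j\<in>UNIV. \<Sum>i\<in>UNIV. X $ i $ j * Y $ i $ j)"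
    by (simp add: frob_inner_def trace_def matrix_matrix_mult_def transpose_def)
  also have "\<dots> = (\<Sum>i\<in>UNIV. \<Sum>j\<in>UNIV. X $ i $ j * Y $ i $ j)"
    by (rule sum.swap)
  finally show ?thesis
    by (simp add: inner_vec_def)
qed

lemma frob_norm_eq_norm: "frob_norm X = norm X"
  by (simp add: frob_norm_def frob_inner_eq_inner norm_eq_sqrt_inner)

lemma linear_lyapunov: "linear (lyapunov A)"
proof (rule linearI)
  show "lyapunov A (X + Y) = lyapunov A X + lyapunov A Y" for X Y
    by (simp add: lyapunov_def vec_eq_iff matrix_matrix_mult_def sum.distrib algebra_simps)
  show "lyapunov A (r *\<^sub>R X) = r *\<^sub>R lyapunov A X" for r X
    by (simp add: lyapunov_def vec_eq_iff matrix_matrix_mult_def sum_distrib_left algebra_simps)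
qed

lemma transpose_lyapunov: "transpose (lyapunov A X) = lyapunov A (transpose X)"
  by (simp add: lyapunov_def vec_eq_iff matrix_matrix_mult_def transpose_def mult.commute add.commute)

lemma linear_transpose: "linear (transpose :: real^'n^'m \<Rightarrow> real^'m^'n)"
  by (rule linearI) (simp_all add: vec_eq_iff transpose_def)

lemma lyapunov_symmetric:
  "X \<in> symmetric_matrices \<Longrightarrow> lyapunov A X \<in> symmetric_matrices"
  by (simp add: symmetric_matrices_def transpose_lyapunov)

lemma lyapunov_skew:
  "X \<in> skew_matrices \<Longrightarrow> lyapunov A X \<in> skew_matrices"
  by (simp add: skew_matrices_def transpose_lyapunov linear_neg[OF linear_lyapunov])

lemma subspace_symmetric_matrices: "subspace symmetric_matrices"
  unfolding subspace_def symmetric_matrices_def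
  by (simp add: linear_0[OF linear_transpose] linear_add[OF linear_transpose]
      linear_scale[OF linear_transpose])

lemma subspace_skew_matrices: "subspace skew_matrices"
  unfolding subspace_def skew_matrices_def
  by (simp add: linear_0[OF linear_transpose] linear_add[OF linear_transpose]
      linear_scale[OF linear_transpose])

lemma lyapunov_ratio_max_exists:
  assumes "subspace U" and "\<exists>X\<in>U. X \<noteq> 0"
  shows "\<exists>X\<in>U. X \<noteq> 0 \<and> (\<forall>Y\<in>U. Y \<noteq> 0 \<longrightarrow> lyapunov_ratio A Y \<le> lyapunov_ratio A X)"
proof -
  let ?S = "U \<inter> sphere 0 1"
  have lin: "linear (lyapunov A)"
    by (rule linear_lyapunov)
  have unit: "(1 / norm X) *\<^sub>R X \<in> ?S" if "X \<in> U" "X \<noteq> 0" for X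
    using that assms(1) by (simp add: subspace_scale)
  have "compact ?S"
    using closed_subspace[OF assms(1)] by (simp add: closed_Int_compact)
  moreover have "?S \<noteq> {}"
    using assms(2) unit by blast
  moreover have "continuous_on ?S (\<lambda>X. norm (lyapunov A X))"
    using lin by (intro continuous_on_norm linear_continuous_on)
       (simp only: linear_conv_bounded_linear)
  ultimately obtain X where X: "X \<in> ?S"
    and max: "\<forall>Y\<in>?S. norm (lyapunov A Y) \<le> norm (lyapunov A X)"
    using continuous_attains_sup by blast
  have "lyapunov_ratio A Y \<le> lyapunov_ratio A X" if "Y \<in> U" "Y \<noteq> 0" for Y
  proof -
    have "lyapunov_ratio A Y = norm (lyapunov A ((1 / norm Y) *\<^sub>R Y))"
      by (simp add: lyapunov_ratio_def frob_norm_eq_norm linear_scale[OF lin])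
    also have "\<dots> \<le> norm (lyapunov A X)"
      using max unit[OF that] by blast
    also have "\<dots> = lyapunov_ratio A X"
      using X by (simp add: lyapunov_ratio_def frob_norm_eq_norm)
    finally show ?thesis .
  qed
  moreover have "X \<in> U" "X \<noteq> 0"
    using X by auto
  ultimately show ?thesis
    by blast
qed

lemma
  assumes "subspace U" and "\<exists>X\<in>U. X \<noteq> 0"
  shows lyapunov_norm_attained: "\<exists>X\<in>U. X \<noteq> 0 \<and> lyapunov_norm A U = lyapunov_ratio A X"
    and lyapunov_norm_upper: "\<And>Y. Y \<in> U \<Longrightarrow> Y \<noteq> 0 \<Longrightarrow> lyapunov_ratio A Y \<le> lyapunov_norm A U"
proof -
  obtain X where X: "X \<in> U" "X \<noteq> 0"
    and max: "\<And>Y. Y \<in> U \<Longrightarrow> Y \<noteq> 0 \<Longrightarrow> lyapunov_ratio A Y \<le> lyapunov_ratio A X"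
    using lyapunov_ratio_max_exists[OF assms] by blast
  have eq: "lyapunov_norm A U = lyapunov_ratio A X"
    unfolding lyapunov_norm_def by (rule Greatest_equality) (use X max in auto)
  show "\<exists>X\<in>U. X \<noteq> 0 \<and> lyapunov_norm A U = lyapunov_ratio A X"
    using X eq by blast
  show "\<And>Y. Y \<in> U \<Longrightarrow> Y \<noteq> 0 \<Longrightarrow> lyapunov_ratio A Y \<le> lyapunov_norm A U"
    using max eq by simp
qed

end

theory Submission
  imports Defs
begin

text \<open>
  On symmetric \<open>X\<close> the squared norm of \<open>A X + X A\<^sup>T\<close> is \<open>2 |A X|\<^sup>2 + 2 tr (A X A X)\<close>, and on
  skew-symmetric \<open>X\<close> the trace term changes its sign.  For the matrix \<open>A7\<close> the two quadratic forms
  have nearly the same largest eigenvalue with respect to the Frobenius norm: about 1195.594 on the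
  symmetric and about 1196.025 on the skew-symmetric matrices.  The number 1196 separates them, so
  both sides can be settled by exact rational arithmetic.

  On the symmetric side the certificate is an upper bound for all \<open>X\<close>: the form
  \<open>(1196 - 1/40) |X|\<^sup>2 - |A X + X A\<^sup>T|\<^sup>2\<close> in the 28 entries on and above the diagonal is a
  combination, with positive weights, of squares of linear forms with integer coefficients
  (\<open>symmetric_form_certificate\<close>, \<open>symmetric_lyapunov_bound\<close>).  On the skew-symmetric side one matrix
  suffices: a multiple of the top eigenvector, rounded to integer entries, already has a
  squared ratio above 1196 (\<open>skew_witness_ratio_greater\<close>).

  The norms are attained maxima, so the bounds on ratios carry over to them.  The maximum over all
  matrices is at least the ratio of the skew-symmetric witness, hence beyond the reach of every
  symmetric matrix.
\<close>

section \<open>Coordinates\<close>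

lemma UNIV_7: "(UNIV :: 7 set) = {1, 2, 3, 4, 5, 6, 7}"
proof -
  have "x \<in> {1, 2, 3, 4, 5, 6, 7}" for x :: 7
  proof (induct x)
    case (of_int z)
    then have "z = 0 \<or> z = 1 \<or> z = 2 \<or> z = 3 \<or> z = 4 \<or> z = 5 \<or> z = 6"
      by fastforce
    then show ?case
      by auto
  qed
  then show ?thesis
    by blast
qed

lemma sum_7: "sum f (UNIV :: 7 set) = f 1 + f 2 + f 3 + f 4 + f 5 + f 6 + f 7"
  unfolding UNIV_7 by (simp add: ac_simps)

lemma norm_matrix_power2:
  fixes X :: "real^'n^'m"
  shows "(norm X)\<^sup>2 = (\<Sum>i\<in>UNIV. \<Sum>j\<in>UNIV. (X $ i $ j)\<^sup>2)"
  unfolding power2_norm_eq_inner by (simp add: inner_vec_def power2_eq_square)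

lemma lyapunov_entry:
  "lyapunov A X $ i $ j = (\<Sum>k\<in>UNIV. A $ i $ k * X $ k $ j) + (\<Sum>k\<in>UNIV. A $ j $ k * X $ i $ k)"
  by (simp add: lyapunov_def matrix_matrix_mult_def transpose_def mult.commute)

lemma lyapunov_ratio_power2: "(lyapunov_ratio A X)\<^sup>2 = (norm (lyapunov A X))\<^sup>2 / (norm X)\<^sup>2"
  by (simp add: lyapunov_ratio_def frob_norm_eq_norm power_divide)

text \<open>
  These rules evaluate a row of \<open>A7\<close> against an arbitrary vector in one step.  Each of the 49 entries of
  \<open>lyapunov A7 X\<close> is a sum of two such products, so zero entries of \<open>A7\<close> never appear in them.
\<close>

lemma A7_row_sum:
  "(\<Sum>k\<in>UNIV. A7 $ 1 $ k * f k) = 0"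
  "(\<Sum>k\<in>UNIV. A7 $ 2 $ k * f k) = 0"
  "(\<Sum>k\<in>UNIV. A7 $ 3 $ k * f k) = 6 * f 1 - 5 * f 2 - 13 * f 3"
  "(\<Sum>k\<in>UNIV. A7 $ 4 $ k * f k) = - 14 * f 1 - 18 * f 2"
  "(\<Sum>k\<in>UNIV. A7 $ 5 $ k * f k) = 12 * f 1 - 12 * f 2 + 11 * f 3"
  "(\<Sum>k\<in>UNIV. A7 $ 6 $ k * f k) = - 6 * f 4 - 14 * f 6"
  "(\<Sum>k\<in>UNIV. A7 $ 7 $ k * f k) = 6 * f 4 - 18 * f 5"
  unfolding sum_7 A7_def vector_7 by simp_all

section \<open>Symmetric matrices\<close>

text \<open>
  The identity is a Cholesky-type factorization over the integers, multiplied by \<open>10\<^sup>6\<close>; the constant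
  1195975000 is \<open>10\<^sup>6 (1196 - 1/40)\<close>, and the two forms on the left are \<open>|X|\<^sup>2\<close> and
  \<open>|A7 X + X A7\<^sup>T|\<^sup>2\<close>, where \<open>xij\<close> stands for the entries \<open>(i,j)\<close> and \<open>(j,i)\<close>.

  The right-hand side has three groups.  The first one comes from completing the square in one variable
  after another, in the order of the leading variables \<open>x57\<close>, \<open>x66\<close>, \<open>x11\<close>, and so on, with all
  coefficients rounded to integers; this order always takes a variable with the fewest remaining
  neighbours and so keeps the linear forms short.  The elimination is applied not to the whole
  form but to what remains of it when about \<open>0.38 |X|\<^sup>2\<close> is set aside from \<open>1196 |X|\<^sup>2\<close>.  Rounding
  leaves small errors \<open>2 e x y\<close>.  They are rewritten as \<open>|e| (x \<plusminus> y)\<^sup>2 - |e| x\<^sup>2 - |e| y\<^sup>2\<close>, whose squares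
  form the second group.  The reserve pays for the negative terms and for the share
  \<open>|X|\<^sup>2 / 40\<close>.  What is left of it, together with the parts of the pivots lost in rounding, is the third
  group; \<open>x77\<close> enters only there, because column 7 of \<open>A7\<close> is zero.
\<close>

lemma symmetric_form_certificate:
  fixes x11 x12 x13 x14 x15 x16 x17 x22 x23 x24 x25 x26 x27 x33
    x34 x35 x36 x37 x44 x45 x46 x47 x55 x56 x57 x66 x67 x77 :: real
  shows "1195975000 * (
    x11^2 + 2 * x12^2 + 2 * x13^2 + 2 * x14^2 + 2 * x15^2 + 2 * x16^2 + 2 * x17^2 + x22^2
    + 2 * x23^2 + 2 * x24^2 + 2 * x25^2 + 2 * x26^2 + 2 * x27^2 + x33^2 + 2 * x34^2 + 2 * x35^2
    + 2 * x36^2 + 2 * x37^2 + x44^2 + 2 * x45^2 + 2 * x46^2 + 2 * x47^2 + x55^2 + 2 * x56^2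
    + 2 * x57^2 + x66^2 + 2 * x67^2 + x77^2)
  - 1000000 * (
    2 * (6 * x11 - 5 * x12 - 13 * x13)^2 + 2 * (- 14 * x11 - 18 * x12)^2
    + 2 * (12 * x11 - 12 * x12 + 11 * x13)^2 + 2 * (- 6 * x14 - 14 * x16)^2
    + 2 * (6 * x14 - 18 * x15)^2 + 2 * (6 * x12 - 5 * x22 - 13 * x23)^2
    + 2 * (- 14 * x12 - 18 * x22)^2 + 2 * (12 * x12 - 12 * x22 + 11 * x23)^2
    + 2 * (- 6 * x24 - 14 * x26)^2 + 2 * (6 * x24 - 18 * x25)^2 + (12 * x13 - 10 * x23 - 26 * x33)^2
    + 2 * (- 14 * x13 + 6 * x14 - 18 * x23 - 5 * x24 - 13 * x34)^2
    + 2 * (12 * x13 + 6 * x15 - 12 * x23 - 5 * x25 + 11 * x33 - 13 * x35)^2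
    + 2 * (6 * x16 - 5 * x26 - 6 * x34 - 27 * x36)^2
    + 2 * (6 * x17 - 5 * x27 + 6 * x34 - 18 * x35 - 13 * x37)^2 + (- 28 * x14 - 36 * x24)^2
    + 2 * (12 * x14 - 14 * x15 - 12 * x24 - 18 * x25 + 11 * x34)^2
    + 2 * (- 14 * x16 - 18 * x26 - 6 * x44 - 14 * x46)^2
    + 2 * (- 14 * x17 - 18 * x27 + 6 * x44 - 18 * x45)^2 + (24 * x15 - 24 * x25 + 22 * x35)^2
    + 2 * (12 * x16 - 12 * x26 + 11 * x36 - 6 * x45 - 14 * x56)^2
    + 2 * (12 * x17 - 12 * x27 + 11 * x37 + 6 * x45 - 18 * x55)^2 + (- 12 * x46 - 28 * x66)^2
    + 2 * (6 * x46 - 6 * x47 - 18 * x56 - 14 * x67)^2 + (12 * x47 - 36 * x57)^2) =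
    33803 * (180 * x57 + 71 * x47)^2 + 171436 * (49 * x66 - 40 * x46)^2
    + 1305 * (583 * x11 - 205 * x12 - 142 * x13)^2 + 11850 * (133 * x22 - 99 * x12 + 85 * x23)^2
    + 2911 * (407 * x12 + 81 * x13 - 7 * x23)^2
    + 796 * (1587 * x47 + 57 * x46 - 171 * x56 - 133 * x67)^2
    + 20926 * (308 * x67 + 27 * x46 - 81 * x56)^2
    + 6556 * (289 * x55 + 228 * x17 - 228 * x27 + 209 * x37 + 114 * x45)^2
    + 8216 * (426 * x46 - 112 * x16 - 144 * x26 - 48 * x44 + 77 * x56)^2
    + 901 * (555 * x33 + 96 * x13 - 264 * x15 + 8 * x23 + 220 * x25 + 572 * x35)^2
    + 147 * (2787 * x56 + 993 * x16 - 598 * x26 + 752 * x36 + 74 * x44 - 410 * x45)^2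
    + 95 * (2530 * x36 - 207 * x16 + 250 * x26 - 1348 * x34 - 34 * x44 + 738 * x45)^2
    + 211 * (2688 * x37 - 741 * x17 + 787 * x27 + 275 * x34 - 825 * x35 - 508 * x45)^2
    + 444 * (1632 * x17 + 425 * x27 - 40 * x34 + 120 * x35 + 232 * x44 - 1239 * x45)^2
    + 333 * (1601 * x27 + 41 * x34 - 123 * x35 + 323 * x44 - 29 * x45)^2
    + 183 * (2306 * x44 - 530 * x16 - 629 * x26 - 11 * x34 + 2 * x35 + 838 * x45)^2
    + 197 * (1705 * x45 + 892 * x16 - 301 * x26 + 310 * x34 - 71 * x35)^2
    + 906 * (932 * x16 - 199 * x14 - 242 * x26 - 12 * x34 + 15 * x35)^2
    + 85 * (2746 * x26 - 187 * x14 - 720 * x24 - 58 * x34 - 3 * x35)^2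
    + 115 * (2849 * x13 + 513 * x14 - 370 * x15 - 290 * x23 - 427 * x24 + 308 * x25 - 1111 * x34 + 801 * x35)^2
    + 226 * (2139 * x14 + 1187 * x15 + 482 * x23 - 1337 * x24 + 856 * x25 - 94 * x34 - 92 * x35)^2
    + 137 * (1495 * x15 + 21 * x23 + 22 * x24 - 157 * x25 + 1396 * x34 - 865 * x35)^2
    + 168 * (1932 * x23 - 150 * x24 - 629 * x25 - 1537 * x34 - 853 * x35)^2
    + 1816 * (278 * x24 + 84 * x25 + 9 * x34 - 15 * x35)^2
    + 7205 * (152 * x25 + 292 * x34 + 153 * x35)^2 + 16887 * (46 * x34 - 5 * x35)^2
    + 270624 * x35^2
    +
    32925 * (x11 - x12)^2 + 35730 * (x11 + x13)^2 + 44513 * (x12 + x13)^2 + 11189 * (x12 + x23)^2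
    + 76755 * (x13 - x14)^2 + 59894 * (x13 + x15)^2 + 27281 * (x13 - x23)^2 + 99855 * (x13 - x24)^2
    + 59300 * (x13 + x25)^2 + 2485 * (x13 + x34)^2 + 88653 * (x13 + x35)^2 + 15732 * (x14 + x15)^2
    + 103002 * (x14 + x23)^2 + 70983 * (x14 + x24)^2 + 27156 * (x14 + x25)^2
    + 101077 * (x14 - x34)^2 + 124182 * (x14 - x35)^2 + 39987 * (x15 - x23)^2 + 8486 * (x15 - x24)^2
    + 40837 * (x15 - x25)^2 + 21838 * (x15 + x34)^2 + 14163 * (x15 - x35)^2 + 34008 * (x14 + x16)^2
    + 71662 * (x16 - x26)^2 + 82954 * (x16 + x34)^2 + 4504 * (x16 + x35)^2 + 103059 * (x17 - x27)^2
    + 19155 * (x17 - x34)^2 + 57465 * (x17 + x35)^2 + 109056 * (x17 - x44)^2 + 40548 * (x17 - x45)^2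
    + 28950 * (x12 + x22)^2 + 35750 * (x22 + x23)^2 + 24740 * (x23 + x24)^2 + 50241 * (x23 + x25)^2
    + 44778 * (x23 + x34)^2 + 35949 * (x23 - x35)^2 + 9822 * (x24 - x25)^2 + 7941 * (x24 + x34)^2
    + 34831 * (x24 + x35)^2 + 14432 * (x25 - x34)^2 + 29871 * (x25 + x35)^2 + 16522 * (x14 + x26)^2
    + 55200 * (x24 + x26)^2 + 37649 * (x26 + x34)^2 + 9137 * (x26 + x35)^2 + 23872 * (x27 + x34)^2
    + 71616 * (x27 - x35)^2 + 19641 * (x27 + x44)^2 + 20665 * (x27 + x45)^2 + 5280 * (x13 - x33)^2
    + 14520 * (x15 + x33)^2 + 440 * (x23 - x33)^2 + 12100 * (x25 - x33)^2 + 31460 * (x33 - x35)^2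
    + 31931 * (x34 - x35)^2 + 17742 * (x16 - x36)^2 + 17812 * (x26 + x36)^2 + 8200 * (x34 - x36)^2
    + 8356 * (x36 - x44)^2 + 55260 * (x36 - x45)^2 + 135024 * (x17 - x37)^2 + 45296 * (x27 + x37)^2
    + 28800 * (x34 + x37)^2 + 86400 * (x35 - x37)^2 + 81912 * (x37 - x45)^2 + 19260 * (x16 + x44)^2
    + 39706 * (x26 - x44)^2 + 1661 * (x34 - x44)^2 + 24801 * (x35 + x44)^2 + 44481 * (x44 - x45)^2
    + 29080 * (x16 + x45)^2 + 7909 * (x26 - x45)^2 + 61179 * (x34 - x45)^2 + 62864 * (x35 - x45)^2
    + 1792 * (x16 + x46)^2 + 2304 * (x26 + x46)^2 + 768 * (x44 + x46)^2 + 22542 * (x46 + x56)^2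
    + 5364 * (x46 - x47)^2 + 16092 * (x47 + x56)^2 + 12516 * (x47 + x67)^2 + 12048 * (x17 + x55)^2
    + 12048 * (x27 - x55)^2 + 11044 * (x37 + x55)^2 + 6024 * (x45 + x55)^2 + 33607 * (x16 + x56)^2
    + 93030 * (x26 + x56)^2 + 86128 * (x36 - x56)^2 + 49350 * (x44 + x56)^2 + 27510 * (x45 - x56)^2
    + 2340 * (x47 - x57)^2 + 14560 * (x46 + x66)^2 + 13860 * (x46 + x67)^2 + 41580 * (x56 - x67)^2
    +
    351200 * x11^2 + 643709 * x12^2 + 301432 * x13^2 + 242731 * x14^2 + 569528 * x15^2
    + 450177 * x16^2 + 250194 * x17^2 + 295650 * x22^2 + 442117 * x23^2 + 421661 * x24^2
    + 467528 * x25^2 + 473261 * x26^2 + 416407 * x27^2 + 380675 * x33^2 + 223130 * x34^2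
    + 2173 * x35^2 + 541914 * x36^2 + 641304 * x37^2 + 46663 * x44^2 + 339054 * x45^2
    + 743136 * x46^2 + 731841 * x47^2 + 370160 * x55^2 + 492932 * x56^2 + 730460 * x57^2
    + 342604 * x66^2 + 677536 * x67^2
    + 1195975000 * x77^2"
  by algebra

text \<open>
  The margin \<open>1/40\<close> turns the later comparison with 1196 into a strict one.
\<close>

lemma symmetric_form_bound:
  fixes x11 x12 x13 x14 x15 x16 x17 x22 x23 x24 x25 x26 x27 x33
    x34 x35 x36 x37 x44 x45 x46 x47 x55 x56 x57 x66 x67 x77 :: real
  shows "(
    2 * (6 * x11 - 5 * x12 - 13 * x13)^2 + 2 * (- 14 * x11 - 18 * x12)^2
    + 2 * (12 * x11 - 12 * x12 + 11 * x13)^2 + 2 * (- 6 * x14 - 14 * x16)^2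
    + 2 * (6 * x14 - 18 * x15)^2 + 2 * (6 * x12 - 5 * x22 - 13 * x23)^2
    + 2 * (- 14 * x12 - 18 * x22)^2 + 2 * (12 * x12 - 12 * x22 + 11 * x23)^2
    + 2 * (- 6 * x24 - 14 * x26)^2 + 2 * (6 * x24 - 18 * x25)^2 + (12 * x13 - 10 * x23 - 26 * x33)^2
    + 2 * (- 14 * x13 + 6 * x14 - 18 * x23 - 5 * x24 - 13 * x34)^2
    + 2 * (12 * x13 + 6 * x15 - 12 * x23 - 5 * x25 + 11 * x33 - 13 * x35)^2
    + 2 * (6 * x16 - 5 * x26 - 6 * x34 - 27 * x36)^2
    + 2 * (6 * x17 - 5 * x27 + 6 * x34 - 18 * x35 - 13 * x37)^2 + (- 28 * x14 - 36 * x24)^2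
    + 2 * (12 * x14 - 14 * x15 - 12 * x24 - 18 * x25 + 11 * x34)^2
    + 2 * (- 14 * x16 - 18 * x26 - 6 * x44 - 14 * x46)^2
    + 2 * (- 14 * x17 - 18 * x27 + 6 * x44 - 18 * x45)^2 + (24 * x15 - 24 * x25 + 22 * x35)^2
    + 2 * (12 * x16 - 12 * x26 + 11 * x36 - 6 * x45 - 14 * x56)^2
    + 2 * (12 * x17 - 12 * x27 + 11 * x37 + 6 * x45 - 18 * x55)^2 + (- 12 * x46 - 28 * x66)^2
    + 2 * (6 * x46 - 6 * x47 - 18 * x56 - 14 * x67)^2 + (12 * x47 - 36 * x57)^2) \<le> (1196 - 1 / 40) * (
    x11^2 + 2 * x12^2 + 2 * x13^2 + 2 * x14^2 + 2 * x15^2 + 2 * x16^2 + 2 * x17^2 + x22^2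
    + 2 * x23^2 + 2 * x24^2 + 2 * x25^2 + 2 * x26^2 + 2 * x27^2 + x33^2 + 2 * x34^2 + 2 * x35^2
    + 2 * x36^2 + 2 * x37^2 + x44^2 + 2 * x45^2 + 2 * x46^2 + 2 * x47^2 + x55^2 + 2 * x56^2
    + 2 * x57^2 + x66^2 + 2 * x67^2 + x77^2)"
    (is "?E \<le> (1196 - 1 / 40) * ?N")
proof -
  have "0 \<le> 1195975000 * ?N - 1000000 * ?E"
    unfolding symmetric_form_certificate by (intro add_nonneg_nonneg mult_nonneg_nonneg) simp_all
  then show ?thesis
    by simp
qed

lemma symmetric_lyapunov_bound:
  assumes "X \<in> symmetric_matrices"
  shows "(norm (lyapunov A7 X))\<^sup>2 \<le> (1196 - 1 / 40) * (norm X)\<^sup>2"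
proof -
  have "X $ i $ j = X $ j $ i" for i j
    using assms by (metis (mono_tags) mem_Collect_eq symmetric_matrices_def transpose_def vec_lambda_beta)
  then have sym: "X $ 2 $ 1 = X $ 1 $ 2" "X $ 3 $ 1 = X $ 1 $ 3" "X $ 3 $ 2 = X $ 2 $ 3"
    "X $ 4 $ 1 = X $ 1 $ 4" "X $ 4 $ 2 = X $ 2 $ 4" "X $ 4 $ 3 = X $ 3 $ 4"
    "X $ 5 $ 1 = X $ 1 $ 5" "X $ 5 $ 2 = X $ 2 $ 5" "X $ 5 $ 3 = X $ 3 $ 5" "X $ 5 $ 4 = X $ 4 $ 5"
    "X $ 6 $ 1 = X $ 1 $ 6" "X $ 6 $ 2 = X $ 2 $ 6" "X $ 6 $ 3 = X $ 3 $ 6" "X $ 6 $ 4 = X $ 4 $ 6"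
    "X $ 6 $ 5 = X $ 5 $ 6"
    "X $ 7 $ 1 = X $ 1 $ 7" "X $ 7 $ 2 = X $ 2 $ 7" "X $ 7 $ 3 = X $ 3 $ 7" "X $ 7 $ 4 = X $ 4 $ 7"
    "X $ 7 $ 5 = X $ 5 $ 7" "X $ 7 $ 6 = X $ 6 $ 7"
    by blast+
  note bound = symmetric_form_bound[of
        "X $ 1 $ 1" "X $ 1 $ 2" "X $ 1 $ 3" "X $ 1 $ 4" "X $ 1 $ 6" "X $ 1 $ 5"
        "X $ 2 $ 2" "X $ 2 $ 3" "X $ 2 $ 4" "X $ 2 $ 6" "X $ 2 $ 5" "X $ 3 $ 3"
        "X $ 3 $ 4" "X $ 3 $ 5" "X $ 3 $ 6" "X $ 1 $ 7" "X $ 2 $ 7" "X $ 3 $ 7"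
        "X $ 4 $ 4" "X $ 4 $ 6" "X $ 4 $ 5" "X $ 5 $ 6" "X $ 5 $ 5" "X $ 6 $ 6"
        "X $ 4 $ 7" "X $ 6 $ 7" "X $ 5 $ 7" "X $ 7 $ 7"]
  show ?thesis
  proof (rule ord_eq_le_trans[OF _ ord_le_eq_trans[OF bound]], goal_cases)
    case 1
    show ?case
      unfolding norm_matrix_power2 sum_7 unfolding lyapunov_entry A7_row_sum sym
      by (simp add: power2_eq_square algebra_simps)
  next
    case 2
    show ?case
      unfolding norm_matrix_power2 sum_7 sym by simp
  qed
qed

lemma symmetric_ratio_less:
  assumes "X \<in> symmetric_matrices" and "X \<noteq> 0"
  shows "(lyapunov_ratio A7 X)\<^sup>2 < 1196"
proof -
  have "(lyapunov_ratio A7 X)\<^sup>2 \<le> 1196 - 1 / 40"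
    unfolding lyapunov_ratio_power2 using symmetric_lyapunov_bound[OF assms(1)] assms(2)
    by (subst pos_divide_le_eq) auto
  then show ?thesis
    by simp
qed

section \<open>A skew-symmetric matrix\<close>

text \<open>
  The eigenvector of the largest eigenvalue on skew-symmetric matrices, scaled to Frobenius norm about
  231 and rounded.  The squared norm of its image exceeds 1196 times its own squared norm by
  only 2, out of about 64 million; the gap in the eigenvalue is of relative size \<open>2 \<cdot> 10\<^sup>-\<^sup>5\<close>, so much coarser
  roundings fall below the threshold.
\<close>

definition skew_witness :: "real^7^7" where
  "skew_witness = vector
    [vector [  0,    4,  -9,  41,  71,   4,  6],
     vector [ -4,    0, -11, -59, 105, -12,  3],
     vector [  9,   11,   0,  59, -10,  35, -8],
     vector [-41,   59, -59,   0,   9,   0,  2],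
     vector [-71, -105,  10,  -9,   0, -15,  0],
     vector [ -4,   12, -35,   0,  15,   0,  4],
     vector [ -6,   -3,   8,  -2,   0,  -4,  0]]"

lemma skew_witness_in_skew: "skew_witness \<in> skew_matrices"
proof -
  have all_7: "(\<forall>i :: 7. P i) \<longleftrightarrow> P 1 \<and> P 2 \<and> P 3 \<and> P 4 \<and> P 5 \<and> P 6 \<and> P 7" for P
    using UNIV_7 by (metis UNIV_I insertE singletonD)
  show ?thesis
    unfolding skew_matrices_def mem_Collect_eq vec_eq_iff transpose_def vec_lambda_beta
      uminus_vec_def all_7 skew_witness_def vector_7 by simp
qed

lemma norm_skew_witness: "(norm skew_witness)\<^sup>2 = 53694"
  unfolding norm_matrix_power2 sum_7 skew_witness_def vector_7 by simp

lemma norm_lyapunov_skew_witness: "(norm (lyapunov A7 skew_witness))\<^sup>2 = 1196 * 53694 + 2"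
  unfolding norm_matrix_power2 sum_7
  unfolding lyapunov_entry A7_row_sum skew_witness_def vector_7 by simp

lemma skew_witness_nonzero: "skew_witness \<noteq> 0"
  using norm_skew_witness by auto

lemma skew_witness_ratio_greater: "1196 < (lyapunov_ratio A7 skew_witness)\<^sup>2"
  unfolding lyapunov_ratio_power2 norm_skew_witness norm_lyapunov_skew_witness by simp

section \<open>Comparison of the norms\<close>

lemma ratio_power2_le_norm_power2:
  assumes "subspace U" and "X \<in> U" and "X \<noteq> 0"
  shows "(lyapunov_ratio A X)\<^sup>2 \<le> (lyapunov_norm A U)\<^sup>2"
proof (rule power_mono)
  show "lyapunov_ratio A X \<le> lyapunov_norm A U"
    using assms by (intro lyapunov_norm_upper) auto
  show "0 \<le> lyapunov_ratio A X"
    by (simp add: lyapunov_ratio_def frob_norm_eq_norm)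
qed

theorem theorem2:
  shows "(lyapunov_norm A7 symmetric_matrices)\<^sup>2 < 1196 \<and>
    1196 < (lyapunov_norm A7 skew_matrices)\<^sup>2 \<and>
    \<not> lyapunov_norm A7 skew_matrices \<le> lyapunov_norm A7 symmetric_matrices \<and>
    \<not> (\<exists>X\<in>symmetric_matrices. X \<noteq> 0 \<and> lyapunov_ratio A7 X = lyapunov_norm A7 UNIV)"
proof (intro conjI)
  let ?S = "lyapunov_norm A7 symmetric_matrices" and ?K = "lyapunov_norm A7 skew_matrices"
  have "mat 1 \<in> symmetric_matrices" "(mat 1 :: real^7^7) \<noteq> 0"
    by (simp add: symmetric_matrices_def transpose_mat) (simp add: mat_def vec_eq_iff)
  then have "\<exists>X\<in>symmetric_matrices. X \<noteq> 0 \<and> ?S = lyapunov_ratio A7 X"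
    by (intro lyapunov_norm_attained subspace_symmetric_matrices) blast
  then show S: "?S\<^sup>2 < 1196"
    using symmetric_ratio_less by force
  show K: "1196 < ?K\<^sup>2"
    using skew_witness_ratio_greater ratio_power2_le_norm_power2[OF subspace_skew_matrices
        skew_witness_in_skew skew_witness_nonzero]
    by (rule less_le_trans)
  \<comment> \<open>The squares order the norms only because \<open>?K\<close>, being a ratio, is nonnegative.\<close>
  have "\<exists>X\<in>skew_matrices. X \<noteq> 0 \<and> ?K = lyapunov_ratio A7 X"
    using skew_witness_in_skew skew_witness_nonzero
    by (intro lyapunov_norm_attained subspace_skew_matrices) blast
  then have "0 \<le> ?K"
    by (auto simp: lyapunov_ratio_def frob_norm_eq_norm)
  then show "\<not> ?K \<le> ?S"
    using S K power_mono[of ?K ?S 2] by linarith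
  have "1196 < (lyapunov_norm A7 UNIV)\<^sup>2"
    using skew_witness_ratio_greater ratio_power2_le_norm_power2[OF subspace_UNIV UNIV_I
        skew_witness_nonzero]
    by (rule less_le_trans)
  then show "\<not> (\<exists>X\<in>symmetric_matrices. X \<noteq> 0 \<and> lyapunov_ratio A7 X = lyapunov_norm A7 UNIV)"
    using symmetric_ratio_less by force
qed

end
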